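(* Let $S$ be a set of $n$ sites with weights $w_1,\dots,w_n$ of minimum $1$ and total weight $W=\sum_i w_i$, placed at independent uniformly random positions on the $d$-dimensional torus $\mathbb T^d$ equipped with a $\mathfrak p$-norm. For every fixed $k$, the expected number of non-empty regions of the weighted order-$k$ Voronoi diagram of $S$ is $O(W)$ (with the constant depending only on $k,d,\mathfrak p$). The same holds for sites placed uniformly at random in the hypercube $[0,1]^d$ with the $\mathfrak p$-norm distance.
   Context: $\mathbb T^d$ is $[0,1]^d$ with opposite faces identified ($d$ a fixed constant), with distance $\mathrm{dist}(p,q)=\left(\sum_{i=1}^d|p_i-q_i|_\circ^{\mathfrak p}\right)^{1/\mathfrak p}$ (and $\max_i|p_i-q_i|_\circ$ for $\mathfrak p=\infty$), where $|a-b|_\circ=\min\{|a-b|,1-|a-b|\}$ and $\mathfrak p\in\mathbb N^+\cup\{\infty\}$ is fixed. For sites $s_1,\dots,s_n$ with weights $w_i$, let $\omega_i=w_i^{1/d}$; the weighted distance from a point $p$ to $s_i$ is $\mathrm{dist}(s_i,p)/\omega_i$. For $A\subseteq S$ with $|A|=k$, the order-$k$ Voronoi region of $A$ is the set of points $p$ for which there exists $r$ with $\mathrm{dist}(s_i,p)\le\omega_i r$ for all $s_i\in A$ and $\mathrm{dist}(s_i,p)>\omega_i r$ for all $s_i\notin A$. The weighted order-$k$ Voronoi diagram is the collection of non-empty order-$k$ regions. *)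

theory Defs
  imports "HOL-Analysis.Analysis" "HOL-Probability.Probability"
begin

text \<open>Circular coordinate distance on the unit circle [0,1) with 0 and 1 identified.\<close>
definition circ_dist :: "real \<Rightarrow> real \<Rightarrow> real" where
  "circ_dist a b = min \<bar>a - b\<bar> (1 - \<bar>a - b\<bar>)"

text \<open>Generic p-norm style distance built from a coordinate distance cd.
  The exponent p ranges over the positive naturals together with infinity (enat).\<close>
definition pdist :: "enat \<Rightarrow> (real \<Rightarrow> real \<Rightarrow> real) \<Rightarrow> real^'d \<Rightarrow> real^'d \<Rightarrow> real" where
  "pdist p cd x y =
     (if p = \<infinity> then Max (range (\<lambda>i. cd (x$i) (y$i)))
      else (\<Sum>i\<in>UNIV. (cd (x$i) (y$i)) ^ (the_enat p)) powr (1 / real (the_enat p)))"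

text \<open>Torus distance on T^d (points represented in [0,1]^d) and cube distance.\<close>
definition torus_dist :: "enat \<Rightarrow> real^'d \<Rightarrow> real^'d \<Rightarrow> real" where
  "torus_dist p x y = pdist p circ_dist x y"

definition cube_dist :: "enat \<Rightarrow> real^'d \<Rightarrow> real^'d \<Rightarrow> real" where
  "cube_dist p x y = pdist p (\<lambda>a b. \<bar>a - b\<bar>) x y"

definition unit_cube :: "(real^'d) set" where
  "unit_cube = {x. \<forall>j. 0 \<le> x$j \<and> x$j \<le> 1}"

definition omega :: "'d::finite itself \<Rightarrow> (nat \<Rightarrow> real) \<Rightarrow> nat \<Rightarrow> real" where
  "omega (_::'d itself) w i = w i powr (1 / real CARD('d))"

text \<open>The order-k Voronoi region of A (a subset of the site indices {..<n}), for sites s,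
  weights w and distance dst; points range over the unit cube
  (the representatives of the torus, resp. the hypercube itself).\<close>
definition voronoi_region ::
  "(real^'d \<Rightarrow> real^'d \<Rightarrow> real) \<Rightarrow> nat \<Rightarrow> (nat \<Rightarrow> real^'d) \<Rightarrow> (nat \<Rightarrow> real) \<Rightarrow> nat set \<Rightarrow> (real^'d) set"
where
  "voronoi_region dst n s w A =
     {q \<in> unit_cube. \<exists>r::real.
        (\<forall>i\<in>A. dst (s i) q \<le> omega TYPE('d) w i * r) \<and>
        (\<forall>i\<in>{..<n} - A. dst (s i) q > omega TYPE('d) w i * r)}"

definition num_regions ::
  "(real^'d \<Rightarrow> real^'d \<Rightarrow> real) \<Rightarrow> nat \<Rightarrow> nat \<Rightarrow> (nat \<Rightarrow> real^'d) \<Rightarrow> (nat \<Rightarrow> real) \<Rightarrow> nat"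
where
  "num_regions dst n k s w =
     card {A. A \<subseteq> {..<n} \<and> card A = k \<and> voronoi_region dst n s w A \<noteq> {}}"

definition random_sites :: "nat \<Rightarrow> (nat \<Rightarrow> real^'d) measure" where
  "random_sites n = PiM {..<n} (\<lambda>_. uniform_measure lborel (unit_cube :: (real^'d) set))"

end

theory Submission
  imports Defs
begin

text \<open>
  Let the point \<open>q\<close> and the radius \<open>r\<close> witness that the region of \<open>A\<close> is non-empty. Sites with
  \<open>\<omega>\<^sub>i r \<ge> d\<close> reach the whole space, so they all lie in \<open>A\<close>; they form one of at most \<open>k + 1\<close> nested sets.
  It remains to count the possible traces of \<open>A\<close>, of size \<open>m\<close> say, on the remaining light sites, whose
  total weight is \<open>S\<close>. Let \<open>R\<close> be the least \<open>2\<^sup>j S\<^bsup>-1/d\<^esup>\<close> (\<open>j \<ge> 0\<close>) with \<open>r \<le> R\<close>, and round \<open>q\<close> to a grid of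
  \<open>O(R\<^bsup>-d\<^esup>)\<close> points. A light site lies in \<open>A\<close> with probability \<open>O(w\<^sub>i R\<^sup>d)\<close>, and if \<open>j > 0\<close> it lies outside \<open>A\<close> with
  probability at most \<open>exp (- \<gamma> w\<^sub>i R\<^sup>d)\<close>. With \<open>y = S R\<^sup>d = 2\<^bsup>jd\<^esup>\<close> the union bound gives
  \<open>O(S y\<^bsup>m-1\<^esup> exp (- \<gamma> y))\<close> expected traces at scale \<open>j\<close>, which sums to \<open>O(S)\<close> over \<open>j\<close>.
\<close>

section \<open>Circular distance, the uniform measure on the cube, and probabilities of
  boxes\<close>

lemma circ_dist_triangle: "circ_dist a c \<le> circ_dist a b + \<bar>b - c\<bar>"
  unfolding circ_dist_def by linarith

lemma circ_dist_le_abs: "circ_dist a b \<le> \<bar>a - b\<bar>"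
  unfolding circ_dist_def by simp

lemma circ_dist_nonneg: "0 \<le> a \<Longrightarrow> a \<le> 1 \<Longrightarrow> 0 \<le> b \<Longrightarrow> b \<le> 1 \<Longrightarrow> 0 \<le> circ_dist a b"
  unfolding circ_dist_def by auto

lemma unit_cube_eq_cbox: "(unit_cube :: (real^'d) set) = cbox 0 1"
  by (auto simp: unit_cube_def mem_box_cart)

lemma emeasure_lborel_cbox_cart:
  fixes a b :: "real^'d"
  assumes "\<And>j. a $ j \<le> b $ j"
  shows "emeasure lborel (cbox a b) = ennreal (\<Prod>j\<in>UNIV. b $ j - a $ j)"
proof -
  have ne: "cbox a b \<noteq> {}" using assms by (simp add: interval_ne_empty_cart)
  have "emeasure lborel (cbox a b) = ennreal (measure lborel (cbox a b))"
    by (rule emeasure_eq_ennreal_measure) (simp add: emeasure_lborel_cbox_eq)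
  thus ?thesis using content_cbox_cart[OF ne] by simp
qed

definition uniform_cube :: "(real^'d) measure" where
  "uniform_cube = uniform_measure lborel unit_cube"

lemma emeasure_unit_cube: "emeasure lborel (unit_cube :: (real^'d) set) = 1"
  unfolding unit_cube_eq_cbox by (subst emeasure_lborel_cbox_cart) auto

lemma prob_space_uniform_cube: "prob_space (uniform_cube :: (real^'d) measure)"
  unfolding uniform_cube_def by (rule prob_space_uniform_measure) (simp_all add: emeasure_unit_cube)

lemma sets_uniform_cube [measurable_cong, simp]: "sets (uniform_cube :: (real^'d) measure) = sets borel"
  by (simp add: uniform_cube_def)

lemma space_uniform_cube [simp]: "space (uniform_cube :: (real^'d) measure) = UNIV"
  by (simp add: uniform_cube_def)

lemma emeasure_uniform_cube:
  assumes "S \<in> sets borel"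
  shows "emeasure (uniform_cube :: (real^'d) measure) S = emeasure lborel (unit_cube \<inter> S)"
proof -
  have "unit_cube \<in> sets (lborel :: (real^'d) measure)" by (simp add: unit_cube_eq_cbox)
  thus ?thesis using assms unfolding uniform_cube_def
    by (subst emeasure_uniform_measure)
      (simp_all only: emeasure_unit_cube divide_ennreal_def ennreal_inverse_1 mult_1_right sets_lborel)
qed

text \<open>Two kinds of ball let one argument serve both distances: the larger torus ball bounds
  the event of lying near \<open>c\<close> from above, and the smaller ordinary ball, through its
  complement, bounds the event of lying far from \<open>c\<close>.\<close>

definition torus_box :: "real^'d \<Rightarrow> real \<Rightarrow> (real^'d) set" where
  "torus_box c \<rho> = {x. \<forall>j. circ_dist (x $ j) (c $ j) \<le> \<rho>}"

definition cube_box :: "real^'d \<Rightarrow> real \<Rightarrow> (real^'d) set" where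
  "cube_box c \<rho> = {x. \<forall>j. \<bar>x $ j - c $ j\<bar> \<le> \<rho>}"

lemma torus_box_borel [measurable]: "torus_box c \<rho> \<in> sets borel"
proof -
  have "closed (torus_box c \<rho>)" unfolding torus_box_def circ_dist_def
    by (intro closed_Collect_all closed_Collect_le continuous_intros)
  thus ?thesis by simp
qed

lemma cube_box_borel [measurable]: "cube_box c \<rho> \<in> sets borel"
proof -
  have "closed (cube_box c \<rho>)" unfolding cube_box_def
    by (intro closed_Collect_all closed_Collect_le continuous_intros)
  thus ?thesis by simp
qed

text \<open>Unwrapping each coordinate by a shift of -1, 0 or 1 covers the torus ball by
  \<open>3 ^ CARD('d)\<close> ordinary boxes of side \<open>2 * \<rho>\<close>; the two factors
  combine to 6.\<close>

lemma emeasure_torus_box_le: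
  fixes c :: "real^'d"
  assumes c: "c \<in> unit_cube" and \<rho>: "0 \<le> \<rho>"
  shows "emeasure uniform_cube (torus_box c \<rho>) \<le> ennreal ((6 * \<rho>) ^ CARD('d))"
proof -
  define V where "V = (UNIV :: 'd set) \<rightarrow>\<^sub>E {-1, 0, 1::real}"
  define B where "B v = cbox (\<chi> j. c $ j + v j - \<rho>) (\<chi> j. c $ j + v j + \<rho>)" for v :: "'d \<Rightarrow> real"
  have cardV: "card V = 3 ^ CARD('d)" 
  proof -
    have "card {-1, 0, 1::real} = 3" by simp
    thus ?thesis unfolding V_def by (simp only: card_PiE finite prod_constant)
  qed
  have finV: "finite V" unfolding V_def by (intro finite_PiE) auto
  have "unit_cube \<inter> torus_box c \<rho> \<subseteq> (\<Union>v\<in>V. B v)"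
  proof
    fix x assume x: "x \<in> unit_cube \<inter> torus_box c \<rho>"
    have "\<exists>v. v \<in> {-1, 0, 1} \<and> \<bar>x $ j - c $ j - v\<bar> \<le> \<rho>" for j
    proof -
      have "0 \<le> x $ j" "x $ j \<le> 1" "0 \<le> c $ j" "c $ j \<le> 1" "circ_dist (x $ j) (c $ j) \<le> \<rho>"
        using x c by (auto simp: unit_cube_def torus_box_def)
      then consider "\<bar>x $ j - c $ j - (-1)\<bar> \<le> \<rho>" | "\<bar>x $ j - c $ j - 0\<bar> \<le> \<rho>" | "\<bar>x $ j - c $ j - 1\<bar> \<le> \<rho>"
        unfolding circ_dist_def by linarith
      thus ?thesis by cases blast+
    qed
    then obtain v where v: "\<And>j. v j \<in> {-1, 0, 1} \<and> \<bar>x $ j - c $ j - v j\<bar> \<le> \<rho>" by metis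
    hence "v \<in> V" by (auto simp: V_def)
    moreover have "x \<in> B v" using v by (auto simp: B_def mem_box_cart abs_le_iff algebra_simps)
    ultimately show "x \<in> (\<Union>v\<in>V. B v)" by blast
  qed
  hence "emeasure uniform_cube (torus_box c \<rho>) \<le> emeasure lborel (\<Union>v\<in>V. B v)"
    by (subst emeasure_uniform_cube) (auto simp: B_def intro!: emeasure_mono sets.finite_UN finV)
  also have "\<dots> \<le> (\<Sum>v\<in>V. emeasure lborel (B v))"
    by (rule emeasure_subadditive_finite) (auto simp: finV B_def)
  also have "\<dots> = (\<Sum>v\<in>V. ennreal ((2 * \<rho>) ^ CARD('d)))"
  proof (rule sum.cong[OF refl])
    fix v
    have "emeasure lborel (B v) = ennreal (\<Prod>j\<in>(UNIV::'d set). (c $ j + v j + \<rho>) - (c $ j + v j - \<rho>))"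
      unfolding B_def using \<rho> by (subst emeasure_lborel_cbox_cart) auto
    also have "(\<Prod>j\<in>(UNIV::'d set). (c $ j + v j + \<rho>) - (c $ j + v j - \<rho>)) = (2 * \<rho>) ^ CARD('d)"
      by simp
    finally show "emeasure lborel (B v) = ennreal ((2 * \<rho>) ^ CARD('d))" .
  qed
  also have "\<dots> = ennreal (3 ^ CARD('d) * (2 * \<rho>) ^ CARD('d))"
    using \<rho> by (simp add: cardV ennreal_mult ennreal_power flip: ennreal_numeral)
  also have "3 ^ CARD('d) * (2 * \<rho>) ^ CARD('d) = (6 * \<rho>) ^ CARD('d)"
    by (simp only: power_mult_distrib[symmetric] mult.assoc[symmetric]) simp
  finally show ?thesis .
qed

text \<open>The ball meets the unit cube in at least a box of side \<open>\<rho>\<close>, even when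
  \<open>c\<close> is a corner of the cube. The form \<open>exp (- x)\<close>, from 1 - x \<le>
  \<open>exp (- x)\<close>, makes independent sites add up in the exponent.\<close>

lemma emeasure_compl_cube_box_le:
  fixes c :: "real^'d"
  assumes c: "c \<in> unit_cube" and \<rho>: "0 \<le> \<rho>" "\<rho> \<le> 1/2"
  shows "emeasure uniform_cube (- cube_box c \<rho>) \<le> ennreal (exp (- (\<rho> ^ CARD('d))))"
proof -
  interpret prob_space "uniform_cube :: (real^'d) measure" by (rule prob_space_uniform_cube)
  \<comment> \<open>The box has a corner at \<open>c\<close> and extends in each coordinate towards
    the farther face of the cube; \<open>\<rho> \<le> 1/2\<close> leaves room for it.\<close>
  define a :: "real^'d" where "a = (\<chi> j. if c $ j \<le> 1/2 then c $ j else c $ j - \<rho>)"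
  have "cbox a (\<chi> j. a $ j + \<rho>) \<subseteq> unit_cube \<inter> cube_box c \<rho>"
  proof
    fix x assume x: "x \<in> cbox a (\<chi> j. a $ j + \<rho>)"
    have "0 \<le> x $ j \<and> x $ j \<le> 1 \<and> \<bar>x $ j - c $ j\<bar> \<le> \<rho>" for j
    proof -
      have "a $ j \<le> x $ j" "x $ j \<le> a $ j + \<rho>" using x by (auto simp: mem_box_cart)
      moreover have "0 \<le> c $ j" "c $ j \<le> 1" using c by (auto simp: unit_cube_def)
      ultimately show ?thesis using \<rho> by (auto simp: a_def split: if_splits)
    qed
    thus "x \<in> unit_cube \<inter> cube_box c \<rho>" by (auto simp: unit_cube_def cube_box_def)
  qed
  hence "emeasure lborel (cbox a (\<chi> j. a $ j + \<rho>)) \<le> emeasure uniform_cube (cube_box c \<rho>)"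
    by (subst emeasure_uniform_cube) (auto intro!: emeasure_mono simp: unit_cube_eq_cbox)
  moreover have "emeasure lborel (cbox a (\<chi> j. a $ j + \<rho>)) = ennreal (\<rho> ^ CARD('d))"
    using \<rho> by (subst emeasure_lborel_cbox_cart) auto
  ultimately have "\<rho> ^ CARD('d) \<le> prob (cube_box c \<rho>)"
    by (simp add: emeasure_eq_measure)
  moreover have "prob (- cube_box c \<rho>) = 1 - prob (cube_box c \<rho>)"
    using prob_compl[of "cube_box c \<rho>"] by (simp add: Compl_eq_Diff_UNIV)
  ultimately have "prob (- cube_box c \<rho>) \<le> 1 + (- (\<rho> ^ CARD('d)))" by simp
  also have "\<dots> \<le> exp (- (\<rho> ^ CARD('d)))" by (rule exp_ge_add_one_self)
  finally show ?thesis by (simp add: emeasure_eq_measure)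
qed

section \<open>Comparison of the norm distances with coordinate distances\<close>

lemma coord_le_pdist:
  fixes x y :: "real^'d"
  assumes p: "p \<ge> 1" and nn: "\<And>j. 0 \<le> cd (x $ j) (y $ j)"
  shows "cd (x $ j) (y $ j) \<le> pdist p cd x y"
proof (cases p)
  case infinity
  thus ?thesis by (auto simp: pdist_def)
next
  case (enat m)
  hence m: "m \<ge> 1" using p by (simp add: one_enat_def)
  have "cd (x $ j) (y $ j) = (cd (x $ j) (y $ j) ^ m) powr (1 / real m)"
    using m nn[of j] by (cases "cd (x $ j) (y $ j) = 0") (auto simp: powr_powr simp flip: powr_realpow)
  also have "\<dots> \<le> (\<Sum>i\<in>UNIV. cd (x $ i) (y $ i) ^ m) powr (1 / real m)"
    by (intro powr_mono2 member_le_sum) (auto simp: nn)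
  finally show ?thesis using enat by (simp add: pdist_def)
qed

text \<open>The natural factor would be the \<open>m\<close>-th root of the dimension. Since
  \<open>real CARD('d)\<close> is at least 1, it is at most its own \<open>m\<close>-th power, which
  gives a factor that does not depend on \<open>p\<close>.\<close>

lemma pdist_le:
  fixes x y :: "real^'d"
  assumes p: "p \<ge> 1" and nn: "\<And>j. 0 \<le> cd (x $ j) (y $ j)" and le: "\<And>j. cd (x $ j) (y $ j) \<le> t"
  shows "pdist p cd x y \<le> real CARD('d) * t"
proof -
  have t: "0 \<le> t" using nn le order_trans by blast
  have d: "1 \<le> real CARD('d)" by (simp add: Suc_leI)
  show ?thesis
  proof (cases p)
    case infinity
    hence "pdist p cd x y \<le> t" using le by (auto simp: pdist_def)
    also have "t \<le> real CARD('d) * t" using mult_right_mono[OF d t] by simp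
    finally show ?thesis .
  next
    case (enat m)
    hence m: "m \<ge> 1" using p by (simp add: one_enat_def)
    have "(\<Sum>i\<in>(UNIV::'d set). cd (x $ i) (y $ i) ^ m) \<le> (\<Sum>i\<in>(UNIV::'d set). t ^ m)"
      by (intro sum_mono power_mono nn le)
    also have "\<dots> = real CARD('d) * t ^ m" by simp
    also have "\<dots> \<le> real CARD('d) ^ m * t ^ m"
      using m d t by (intro mult_right_mono self_le_power) auto
    also have "\<dots> = (real CARD('d) * t) ^ m" by (simp add: power_mult_distrib)
    finally have "(\<Sum>i\<in>(UNIV::'d set). cd (x $ i) (y $ i) ^ m) powr (1 / real m)
        \<le> ((real CARD('d) * t) ^ m) powr (1 / real m)"
      by (intro powr_mono2 sum_nonneg) (auto simp: nn)
    also have "\<dots> = real CARD('d) * t"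
      using m t d by (cases "t = 0") (auto simp: powr_powr simp flip: powr_realpow)
    finally show ?thesis using enat by (simp add: pdist_def)
  qed
qed

text \<open>All that is used about the \<open>p\<close>-norm.\<close>
definition cube_comparable :: "(real^'d \<Rightarrow> real^'d \<Rightarrow> real) \<Rightarrow> bool" where
  "cube_comparable dst \<longleftrightarrow> (\<forall>x\<in>unit_cube. \<forall>y\<in>unit_cube.
     (\<forall>j. circ_dist (x $ j) (y $ j) \<le> dst x y) \<and>
     (\<forall>t. (\<forall>j. \<bar>x $ j - y $ j\<bar> \<le> t) \<longrightarrow> dst x y \<le> real CARD('d) * t))"

lemma cube_comparable_torus_dist:
  assumes "p \<ge> 1" shows "cube_comparable (torus_dist p :: real^'d \<Rightarrow> _)"
  unfolding cube_comparable_def torus_dist_def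
  by (auto simp: unit_cube_def intro!: coord_le_pdist pdist_le assms circ_dist_nonneg
      intro: order_trans[OF circ_dist_le_abs])

lemma cube_comparable_cube_dist:
  assumes "p \<ge> 1" shows "cube_comparable (cube_dist p :: real^'d \<Rightarrow> _)"
  unfolding cube_comparable_def cube_dist_def
  by (auto simp: unit_cube_def intro!: pdist_le assms
      intro: order_trans[OF circ_dist_le_abs coord_le_pdist[where cd = "\<lambda>a b. \<bar>a - b\<bar>"]])

section \<open>Elementary symmetric sums and exponential decay\<close>

text \<open>After scaling \<open>f\<close> to total 1, the sum over all subsets is the expansion of
  the product of \<open>1 + f i\<close>, which is at most the exponential of the total. This bounds
  the union over all traces of size \<open>m\<close>.\<close>

lemma sum_prod_subsets_le:
  fixes f :: "'a \<Rightarrow> real"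
  assumes "finite L" and pos: "\<And>i. i \<in> L \<Longrightarrow> 0 \<le> f i" and sum: "sum f L > 0"
  shows "(\<Sum>A | A \<subseteq> L \<and> card A = m. \<Prod>i\<in>A. f i) \<le> exp 1 * sum f L ^ m"
proof -
  let ?S = "sum f L"
  have "(\<Sum>A | A \<subseteq> L \<and> card A = m. \<Prod>i\<in>A. f i) = ?S ^ m * (\<Sum>A | A \<subseteq> L \<and> card A = m. \<Prod>i\<in>A. f i / ?S)"
    unfolding sum_distrib_left using sum by (intro sum.cong) (auto simp: prod_dividef)
  also have "(\<Sum>A | A \<subseteq> L \<and> card A = m. \<Prod>i\<in>A. f i / ?S) \<le> (\<Sum>A\<in>Pow L. \<Prod>i\<in>A. f i / ?S)"
    using assms by (intro sum_mono2) (auto intro!: prod_nonneg)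
  also have "\<dots> = (\<Prod>i\<in>L. f i / ?S + 1)"
    using assms(1) by (simp add: prod_add)
  also have "\<dots> \<le> (\<Prod>i\<in>L. exp (f i / ?S))"
    using pos sum by (intro prod_mono) (auto intro!: add_nonneg_nonneg simp: exp_ge_add_one_self add.commute)
  also have "\<dots> = exp 1" using assms(1) sum by (simp flip: exp_sum sum_divide_distrib)
  finally show ?thesis using sum by (simp add: mult.commute)
qed

text \<open>The exponential dominates the single term of degree \<open>m\<close> in its
  series.\<close>

lemma power_mult_exp_minus_le:
  assumes "0 < g" "0 \<le> (y::real)"
  shows "y ^ m * exp (- (g * y)) \<le> fact m / g ^ m"
proof -
  have "(g * y) ^ m / fact m \<le> exp (g * y)"
  proof -
    have "(\<Sum>i\<in>{m}. (g * y) ^ i /\<^sub>R fact i) \<le> exp (g * y)" unfolding exp_def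
      using assms by (intro sum_le_suminf summable_exp_generic) auto
    thus ?thesis by (simp add: field_simps)
  qed
  thus ?thesis using assms by (simp add: exp_minus field_simps power_mult_distrib)
qed

section \<open>The event attached to a trace, a grid point and a scale\<close>

lemma omega_ge_1: "1 \<le> w i \<Longrightarrow> 1 \<le> omega TYPE('d::finite) w i"
  unfolding omega_def by (rule ge_one_powr_ge_zero) auto

lemma omega_power: "1 \<le> w i \<Longrightarrow> omega TYPE('d::finite) w i ^ CARD('d) = w i"
  unfolding omega_def by (simp add: powr_powr flip: powr_realpow)

text \<open>The flag \<open>b\<close> is off at the smallest scale, where \<open>r\<close> has no lower bound in terms of \<open>R\<close>, so that
  nothing is known about the sites outside \<open>A\<close>.\<close>
definition site_event ::
  "nat \<Rightarrow> nat set \<Rightarrow> (nat \<Rightarrow> real) \<Rightarrow> nat set \<Rightarrow> real^'d \<Rightarrow> real \<Rightarrow> bool \<Rightarrow> (nat \<Rightarrow> real^'d) set" where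
  "site_event n L w A c R b = Pi\<^sub>E {..<n} (\<lambda>i.
     if i \<in> A then torus_box c (2 * (omega TYPE('d) w i * R))
     else if b \<and> i \<in> L then - cube_box c (omega TYPE('d) w i * R / (4 * real CARD('d)))
     else UNIV)"

lemma random_sites_eq: "random_sites n = PiM {..<n} (\<lambda>_. uniform_cube)"
  by (simp add: random_sites_def uniform_cube_def)

lemma prob_space_random_sites: "prob_space (random_sites n :: (nat \<Rightarrow> real^'d) measure)"
  unfolding random_sites_eq by (intro prob_space_PiM prob_space_uniform_cube)

lemma site_event_measurable [measurable]:
  "site_event n L w A c R b \<in> sets (random_sites n :: (nat \<Rightarrow> real^'d) measure)"
  unfolding site_event_def random_sites_eq
  by (intro sets_PiM_I_finite) (auto intro!: borel_comp torus_box_borel cube_box_borel)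

text \<open>By independence the probability is a product over the sites. The constant 12 is the 6 of
  the torus ball times the 2 in its radius; \<open>small\<close> keeps the radii of the ordinary
  balls at most 1/2, as their bound requires.\<close>

lemma emeasure_site_event_le:
  fixes c :: "real^'d"
  assumes L: "L \<subseteq> {..<n}" and A: "A \<subseteq> L" and c: "c \<in> unit_cube" and R: "R > 0"
    and w: "\<And>i. i < n \<Longrightarrow> 1 \<le> w i"
    and small: "\<And>i. b \<Longrightarrow> i \<in> L \<Longrightarrow> omega TYPE('d) w i * R \<le> 2 * real CARD('d)"
  shows "emeasure (random_sites n) (site_event n L w A c R b) \<le>
    ennreal ((\<Prod>i\<in>A. 12 ^ CARD('d) * (w i * R ^ CARD('d))) *
      (if b then \<Prod>i\<in>L-A. exp (- (w i * R ^ CARD('d) / (4 * real CARD('d)) ^ CARD('d))) else 1))"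
proof -
  let ?d = "real CARD('d)"
  interpret U: prob_space "uniform_cube :: (real^'d) measure" by (rule prob_space_uniform_cube)
  interpret PP: product_prob_space "\<lambda>_::nat. uniform_cube :: (real^'d) measure" "{..<n}" ..
  let ?X = "\<lambda>i. if i \<in> A then torus_box c (2 * (omega TYPE('d) w i * R))
     else if b \<and> i \<in> L then - cube_box c (omega TYPE('d) w i * R / (4 * ?d)) else UNIV"
  \<comment> \<open>Unconstrained sites get the bound 1, so that the product over all sites
    collapses to one over \<open>L\<close>.\<close>
  define f where "f i = (if i \<in> A then 12 ^ CARD('d) * (w i * R ^ CARD('d))
     else if b \<and> i \<in> L then exp (- (w i * R ^ CARD('d) / (4 * ?d) ^ CARD('d))) else 1)" for i
  have X: "emeasure uniform_cube (?X i) \<le> ennreal (f i)" if i: "i < n" for i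
  proof -
    have o: "1 \<le> omega TYPE('d) w i" using omega_ge_1 w i by blast
    have pw: "omega TYPE('d) w i ^ CARD('d) = w i" using omega_power w i by blast
    consider "i \<in> A" | "i \<notin> A" "b" "i \<in> L" | "i \<notin> A" "\<not> (b \<and> i \<in> L)" by blast
    thus ?thesis
    proof cases
      case 1
      have "emeasure uniform_cube (torus_box c (2 * (omega TYPE('d) w i * R)))
        \<le> ennreal ((6 * (2 * (omega TYPE('d) w i * R))) ^ CARD('d))"
        using o R by (intro emeasure_torus_box_le c) auto
      also have "(6 * (2 * (omega TYPE('d) w i * R))) ^ CARD('d) = 12 ^ CARD('d) * (w i * R ^ CARD('d))"
        by (simp only: mult.assoc[symmetric]) (simp add: power_mult_distrib pw)
      finally show ?thesis using 1 by (simp add: f_def)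
    next
      case 2
      have "emeasure uniform_cube (- cube_box c (omega TYPE('d) w i * R / (4 * ?d)))
        \<le> ennreal (exp (- ((omega TYPE('d) w i * R / (4 * ?d)) ^ CARD('d))))"
        using o R small[of i] 2 by (intro emeasure_compl_cube_box_le c) (auto simp: field_simps)
      also have "(omega TYPE('d) w i * R / (4 * ?d)) ^ CARD('d) = w i * R ^ CARD('d) / (4 * ?d) ^ CARD('d)"
        by (simp add: power_divide pw power_mult_distrib)
      finally show ?thesis using 2 by (simp add: f_def)
    next
      case 3
      thus ?thesis using U.emeasure_space_1 by (auto simp: f_def)
    qed
  qed
  have f0: "0 \<le> f i" if "i < n" for i
    using w[OF that] R by (auto simp: f_def)
  have "emeasure (random_sites n) (site_event n L w A c R b) = (\<Prod>i<n. emeasure uniform_cube (?X i))"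
    unfolding random_sites_eq site_event_def
    by (rule PP.emeasure_PiM) (auto intro!: borel_comp torus_box_borel cube_box_borel)
  also have "\<dots> = ennreal (\<Prod>i<n. U.prob (?X i))"
    unfolding U.emeasure_eq_measure by (rule prod_ennreal) simp
  also have "\<dots> \<le> ennreal (\<Prod>i<n. f i)"
    using X f0 by (intro ennreal_leI prod_mono) (simp add: U.emeasure_eq_measure)
  also have "(\<Prod>i<n. f i) = (\<Prod>i\<in>L. f i)"
    using L A by (intro prod.mono_neutral_right) (auto simp: f_def)
  also have "\<dots> = (\<Prod>i\<in>A. f i) * (\<Prod>i\<in>L-A. f i)"
    using L A finite_subset by (subst prod.subset_diff[OF A]) (auto simp: mult.commute)
  also have "(\<Prod>i\<in>A. f i) = (\<Prod>i\<in>A. 12 ^ CARD('d) * (w i * R ^ CARD('d)))"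
    by (intro prod.cong) (auto simp: f_def)
  also have "(\<Prod>i\<in>L-A. f i) = (if b then \<Prod>i\<in>L-A. exp (- (w i * R ^ CARD('d) / (4 * ?d) ^ CARD('d))) else 1)"
    by (auto simp: f_def intro!: prod.cong prod.neutral)
  finally show ?thesis .
qed

text \<open>Take the points whose coordinates are multiples of \<open>1 / N\<close>, with
  \<open>N\<close> the ceiling of \<open>4 * CARD('d) / R\<close>. As \<open>R\<close> is at most
  \<open>2 * CARD('d)\<close>, that quotient is at least 2, so doubling it absorbs both the rounding
  up and the extra endpoint in \<open>N + 1\<close>.\<close>

lemma unit_cube_grid:
  assumes R: "0 < R" "R \<le> 2 * real CARD('d)"
  obtains G :: "(real^'d) set" where "finite G" "G \<subseteq> unit_cube"
    "real (card G) \<le> (8 * real CARD('d) / R) ^ CARD('d)"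
    "\<And>q. q \<in> unit_cube \<Longrightarrow> \<exists>c\<in>G. \<forall>j. \<bar>q $ j - c $ j\<bar> \<le> R / (4 * real CARD('d))"
proof -
  let ?d = "real CARD('d)"
  have d: "?d \<ge> 1" by (simp add: Suc_leI)
  define N where "N = nat \<lceil>4 * ?d / R\<rceil>"
  have pos: "4 * ?d / R > 0" using R d by simp
  have N1: "4 * ?d / R \<le> real N" and N2: "real N \<le> 4 * ?d / R + 1"
    unfolding N_def using pos by linarith+
  have N0: "real N > 0" using pos N1 by linarith
  have eps: "1 / real N \<le> R / (4 * ?d)" using N1 N0 R d by (simp add: field_simps)
  define pt :: "('d \<Rightarrow> nat) \<Rightarrow> real^'d" where "pt g = (\<chi> j. real (g j) / real N)" for g
  define G where "G = pt ` (UNIV \<rightarrow>\<^sub>E {..N})"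
  show ?thesis
  proof
    show "finite G" unfolding G_def by (intro finite_imageI finite_PiE) auto
    show "G \<subseteq> unit_cube" using N0 by (auto simp: G_def pt_def unit_cube_def)
    have "real (card G) \<le> real (card ((UNIV :: 'd set) \<rightarrow>\<^sub>E {..N}))"
      unfolding G_def of_nat_le_iff by (intro card_image_le finite_PiE) auto
    also have "\<dots> = (real N + 1) ^ CARD('d)" by (simp add: card_PiE add.commute)
    also have "\<dots> \<le> (8 * ?d / R) ^ CARD('d)"
    proof (intro power_mono)
      have "2 \<le> 4 * ?d / R" using R by (simp add: field_simps)
      thus "real N + 1 \<le> 8 * ?d / R" using N2 by simp
    qed simp
    finally show "real (card G) \<le> (8 * ?d / R) ^ CARD('d)" .
    fix q :: "real^'d" assume q: "q \<in> unit_cube"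
    define g where "g j = nat \<lfloor>q $ j * real N\<rfloor>" for j
    have "g j \<le> N \<and> \<bar>q $ j - pt g $ j\<bar> \<le> 1 / real N" for j
    proof -
      have q': "0 \<le> q $ j" "q $ j \<le> 1" using q by (auto simp: unit_cube_def)
      have "0 \<le> q $ j * real N" using q' N0 by simp
      moreover have "q $ j * real N \<le> real N" using q' N0 by simp
      ultimately have "g j \<le> N" "\<bar>q $ j * real N - real (g j)\<bar> \<le> 1"
        unfolding g_def by linarith+
      moreover have "\<bar>q $ j - pt g $ j\<bar> = \<bar>q $ j * real N - real (g j)\<bar> / real N"
      proof -
        have "q $ j - pt g $ j = (q $ j * real N - real (g j)) / real N"
          using N0 by (simp add: pt_def field_simps)
        thus ?thesis by (simp add: abs_divide)
      qed
      ultimately show ?thesis using N0 by (simp add: divide_right_mono)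
    qed
    hence "pt g \<in> G" "\<And>j. \<bar>q $ j - pt g $ j\<bar> \<le> R / (4 * ?d)"
      using eps order_trans by (auto simp: G_def)
    thus "\<exists>c\<in>G. \<forall>j. \<bar>q $ j - c $ j\<bar> \<le> R / (4 * ?d)" by blast
  qed
qed

text \<open>The last condition says that no site of \<open>L\<close> reaches the whole cube. It
  keeps the event radii admissible even after \<open>r\<close> is rounded up by a factor of
  two.\<close>

definition light_sets ::
  "(real^'d \<Rightarrow> real^'d \<Rightarrow> real) \<Rightarrow> nat set \<Rightarrow> nat \<Rightarrow> (nat \<Rightarrow> real^'d) \<Rightarrow> (nat \<Rightarrow> real) \<Rightarrow> nat set set"
where
  "light_sets dst L m s w = {A. A \<subseteq> L \<and> card A = m \<and>
     (\<exists>q\<in>unit_cube. \<exists>r\<ge>0.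
        (\<forall>i\<in>A. dst (s i) q \<le> omega TYPE('d) w i * r) \<and>
        (\<forall>i\<in>L - A. omega TYPE('d) w i * r < dst (s i) q) \<and>
        (\<forall>i\<in>L. omega TYPE('d) w i * r < real CARD('d)))}"

text \<open>Replacing \<open>q\<close> by \<open>c\<close> moves each coordinate by at most
  \<open>R / (4 * CARD('d))\<close>. For a site in \<open>A\<close> this is absorbed by doubling the
  radius. If a site of \<open>L - A\<close> were in the small ball, its coordinates would differ
  from those of \<open>q\<close> by at most twice the ball radius; the norm comparison then puts its
  distance at most at its scaled weight times \<open>R / 2\<close>, hence times \<open>r\<close>, a
  contradiction.\<close>

lemma mem_site_eventI:
  fixes s :: "nat \<Rightarrow> real^'d"
  assumes dst: "cube_comparable dst" and L: "L \<subseteq> {..<n}" and A: "A \<subseteq> L"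
    and w: "\<And>i. i < n \<Longrightarrow> 1 \<le> w i"
    and s: "s \<in> extensional {..<n}" "\<And>i. i < n \<Longrightarrow> s i \<in> unit_cube"
    and q: "q \<in> unit_cube" and R: "0 < R" "r \<le> R" "b \<Longrightarrow> R \<le> 2 * r"
    and inside: "\<And>i. i \<in> A \<Longrightarrow> dst (s i) q \<le> omega TYPE('d) w i * r"
    and outside: "\<And>i. i \<in> L - A \<Longrightarrow> omega TYPE('d) w i * r < dst (s i) q"
    and c: "\<And>j. \<bar>q $ j - c $ j\<bar> \<le> R / (4 * real CARD('d))"
  shows "s \<in> site_event n L w A c R b"
proof -
  let ?d = "real CARD('d)"
  have d: "?d \<ge> 1" by (simp add: Suc_leI)
  have tor: "s i \<in> torus_box c (2 * (omega TYPE('d) w i * R))" if i: "i \<in> A" for i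
  proof -
    have i': "i < n" using i A L by auto
    have o: "1 \<le> omega TYPE('d) w i" using omega_ge_1 w i' by blast
    have "circ_dist (s i $ j) (c $ j) \<le> 2 * (omega TYPE('d) w i * R)" for j
    proof -
      have "circ_dist (s i $ j) (c $ j) \<le> circ_dist (s i $ j) (q $ j) + \<bar>q $ j - c $ j\<bar>"
        by (rule circ_dist_triangle)
      moreover have "circ_dist (s i $ j) (q $ j) \<le> omega TYPE('d) w i * R"
      proof -
        have "circ_dist (s i $ j) (q $ j) \<le> dst (s i) q"
          using dst s(2)[OF i'] q by (auto simp: cube_comparable_def)
        also have "\<dots> \<le> omega TYPE('d) w i * r" using inside i by blast
        also have "\<dots> \<le> omega TYPE('d) w i * R" using o R by (intro mult_left_mono) auto
        finally show ?thesis .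
      qed
      moreover have "\<bar>q $ j - c $ j\<bar> \<le> omega TYPE('d) w i * R"
      proof -
        note c[of j]
        also have "R / (4 * ?d) \<le> R / 1" using R d by (intro divide_left_mono) linarith+
        also have "\<dots> \<le> omega TYPE('d) w i * R" using o R by simp
        finally show ?thesis .
      qed
      ultimately show ?thesis by linarith
    qed
    thus ?thesis by (simp add: torus_box_def)
  qed
  have cub: "s i \<notin> cube_box c (omega TYPE('d) w i * R / (4 * ?d))" if i: "i \<in> L - A" and b: b for i
  proof
    assume *: "s i \<in> cube_box c (omega TYPE('d) w i * R / (4 * ?d))"
    have i': "i < n" using i A L by auto
    have o: "1 \<le> omega TYPE('d) w i" using omega_ge_1 w i' by blast
    have "\<bar>s i $ j - q $ j\<bar> \<le> omega TYPE('d) w i * R / (2 * ?d)" for j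
    proof -
      have "\<bar>s i $ j - c $ j\<bar> \<le> omega TYPE('d) w i * R / (4 * ?d)" using * by (simp add: cube_box_def)
      moreover have "R / (4 * ?d) \<le> omega TYPE('d) w i * R / (4 * ?d)"
        using o R d by (intro divide_right_mono) auto
      ultimately have "\<bar>s i $ j - q $ j\<bar> \<le> 2 * (omega TYPE('d) w i * R / (4 * ?d))" using c[of j] by linarith
      thus ?thesis by (simp add: mult.commute)
    qed
    hence "dst (s i) q \<le> ?d * (omega TYPE('d) w i * R / (2 * ?d))"
      using dst s(2)[OF i'] q unfolding cube_comparable_def by blast
    also have "\<dots> = omega TYPE('d) w i * (R / 2)" by simp
    also have "\<dots> \<le> omega TYPE('d) w i * r" using o R(3)[OF b] by (intro mult_left_mono) auto
    also have "\<dots> < dst (s i) q" using outside i by blast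
    finally show False by simp
  qed
  show ?thesis unfolding site_event_def
    using s(1) tor cub A by (auto simp: PiE_def)
qed

text \<open>The union bound at one scale, in terms of \<open>y\<close>. The grid has size
  \<open>O(S / y)\<close>, the symmetric sum contributes \<open>y ^ m\<close>, and this power is
  paid for by the exponential. The remaining \<open>S / y\<close> is what makes the scales
  summable.\<close>

lemma sum_scale_le:
  fixes G :: "(real^'d) set"
  assumes L: "finite L" "L \<noteq> {}" and w: "\<And>i. i \<in> L \<Longrightarrow> 1 \<le> w i" and R: "R > 0"
    and y: "y = sum w L * R ^ CARD('d)" "\<not> b \<Longrightarrow> y = 1"
    and small: "\<And>i. b \<Longrightarrow> i \<in> L \<Longrightarrow> omega TYPE('d) w i * R \<le> 2 * real CARD('d)"
    and G: "real (card G) \<le> (8 * real CARD('d) / R) ^ CARD('d)"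
    and g: "g = 1 / (4 * real CARD('d)) ^ CARD('d)"
  shows "(\<Sum>A | A \<subseteq> L \<and> card A = m. \<Sum>c\<in>G. (\<Prod>i\<in>A. 12 ^ CARD('d) * (w i * R ^ CARD('d))) *
      (if b then \<Prod>i\<in>L-A. exp (- (w i * R ^ CARD('d) / (4 * real CARD('d)) ^ CARD('d))) else 1))
    \<le> (8 * real CARD('d)) ^ CARD('d) * (12 ^ CARD('d)) ^ m * exp (real m + 1) * (1 + fact m / g ^ m)
        * sum w L / y"
proof -
  let ?d = "real CARD('d)" and ?S = "sum w L" and ?X = "R ^ CARD('d)"
  have S: "?S > 0" using L w by (intro sum_pos) force+
  have X: "?X > 0" using R by simp
  have y0: "y > 0" using S X y by simp
  have g0: "g > 0" using g by simp
  \<comment> \<open>The product over \<open>L - A\<close> is extended to all of \<open>L\<close>,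
    where the exponent is exactly \<open>- (g * y)\<close>; the \<open>m\<close> added sites cost at
    most a factor \<open>exp 1\<close> each.\<close>
  define E where "E = (if b then exp (real m) * exp (- (g * y)) else 1)"
  have out: "(if b then \<Prod>i\<in>L-A. exp (- (w i * ?X / (4 * ?d) ^ CARD('d))) else 1) \<le> E"
    if A: "A \<subseteq> L" "card A = m" for A
  proof (cases b)
    case True
    have "(\<Prod>i\<in>L-A. exp (- (w i * ?X / (4 * ?d) ^ CARD('d)))) = exp (\<Sum>i\<in>L-A. - (g * ?X * w i))"
      using L by (subst exp_sum) (auto simp: g field_simps)
    also have "(\<Sum>i\<in>L-A. - (g * ?X * w i)) = - (g * y) + (\<Sum>i\<in>A. g * ?X * w i)"
      using L A by (simp add: sum_diff sum_negf y sum_distrib_left sum_distrib_right mult_ac)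
    also have "(\<Sum>i\<in>A. g * ?X * w i) \<le> (\<Sum>i\<in>A. 1)"
    proof (rule sum_mono)
      fix i assume i: "i \<in> A"
      have o: "1 \<le> omega TYPE('d) w i" using omega_ge_1 w i A by blast
      have "g * ?X * w i = (omega TYPE('d) w i * R / (4 * ?d)) ^ CARD('d)"
        using omega_power[where 'd='d, of w i] w i A by (auto simp: g power_divide power_mult_distrib)
      also have "\<dots> \<le> 1"
        using small[OF True, of i] i A o R by (intro power_le_one) (auto simp: field_simps)
      finally show "g * ?X * w i \<le> 1" .
    qed
    also have "(\<Sum>i\<in>A. 1) = real m" using A by simp
    finally show ?thesis using True by (simp add: E_def flip: exp_add)
  qed (simp add: E_def)
  have "(\<Sum>A | A \<subseteq> L \<and> card A = m. \<Sum>c\<in>G. (\<Prod>i\<in>A. 12 ^ CARD('d) * (w i * ?X)) *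
      (if b then \<Prod>i\<in>L-A. exp (- (w i * ?X / (4 * ?d) ^ CARD('d))) else 1))
    \<le> (\<Sum>A | A \<subseteq> L \<and> card A = m. \<Sum>c\<in>G. (\<Prod>i\<in>A. 12 ^ CARD('d) * (w i * ?X)) * E)"
    using out w R by (intro sum_mono mult_left_mono prod_nonneg) force+
  also have "\<dots> = real (card G) * E * (\<Sum>A | A \<subseteq> L \<and> card A = m. \<Prod>i\<in>A. 12 ^ CARD('d) * (w i * ?X))"
    by (simp add: sum_distrib_left mult_ac)
  also have "(\<Sum>A | A \<subseteq> L \<and> card A = m. \<Prod>i\<in>A. 12 ^ CARD('d) * (w i * ?X))
     = (12 ^ CARD('d)) ^ m * ?X ^ m * (\<Sum>A | A \<subseteq> L \<and> card A = m. \<Prod>i\<in>A. w i)"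
    unfolding sum_distrib_left by (intro sum.cong) (auto simp: prod.distrib)
  also have "real (card G) * E * ((12 ^ CARD('d)) ^ m * ?X ^ m * (\<Sum>A | A \<subseteq> L \<and> card A = m. \<Prod>i\<in>A. w i))
    \<le> (8 * ?d / R) ^ CARD('d) * E * ((12 ^ CARD('d)) ^ m * ?X ^ m * (exp 1 * ?S ^ m))"
    using G L w S R by (intro mult_mono sum_prod_subsets_le)
      (force simp: E_def intro!: sum_nonneg prod_nonneg mult_nonneg_nonneg)+
  \<comment> \<open>The grid factor \<open>1 / R ^ CARD('d)\<close> equals
    \<open>?S / y\<close>.\<close>
  also have "\<dots> = (8 * ?d) ^ CARD('d) * (12 ^ CARD('d)) ^ m * exp 1 * (y ^ m * E) * (?S / y)"
    using X S by (simp add: y power_divide power_mult_distrib field_simps)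
  also have "\<dots> \<le> (8 * ?d) ^ CARD('d) * (12 ^ CARD('d)) ^ m * exp 1 * (exp (real m) * (1 + fact m / g ^ m)) * (?S / y)"
  proof (intro mult_right_mono mult_left_mono)
    show "y ^ m * E \<le> exp (real m) * (1 + fact m / g ^ m)"
    proof (cases b)
      case True
      have "y ^ m * E = exp (real m) * (y ^ m * exp (- (g * y)))" using True by (simp add: E_def)
      also have "\<dots> \<le> exp (real m) * (1 + fact m / g ^ m)"
        using power_mult_exp_minus_le[OF g0, of y m] y0 by (intro mult_left_mono) auto
      finally show ?thesis .
    next
      \<comment> \<open>Without exponential decay \<open>y = 1\<close>, so the power is harmless;
        the summand 1 in the constant covers this case.\<close>
      case False
      hence "y ^ m * E = 1 * 1" by (simp add: E_def y(2))
      also have "\<dots> \<le> exp (real m) * (1 + fact m / g ^ m)"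
        using g0 by (intro mult_mono) auto
      finally show ?thesis .
    qed
  qed (use S y0 in auto)
  also have "\<dots> = (8 * ?d) ^ CARD('d) * (12 ^ CARD('d)) ^ m * exp (real m + 1) * (1 + fact m / g ^ m) * ?S / y"
    by (simp add: exp_add)
  finally show ?thesis .
qed

section \<open>Expected number of traces on the light sites\<close>

lemma finite_light_sets: "finite L \<Longrightarrow> finite (light_sets dst L m s w)"
  by (rule finite_subset[of _ "Pow L"]) (auto simp: light_sets_def)

lemma AE_random_sites_unit_cube:
  "AE s in (random_sites n :: (nat \<Rightarrow> real^'d) measure). \<forall>i\<in>{..<n}. s i \<in> unit_cube"
proof (rule AE_finite_allI)
  fix i assume "i \<in> {..<n}"
  moreover have "AE x in (uniform_cube :: (real^'d) measure). x \<in> unit_cube"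
    unfolding uniform_cube_def by (rule AE_uniform_measureI) (auto simp: unit_cube_eq_cbox)
  ultimately show "AE s in (random_sites n :: (nat \<Rightarrow> real^'d) measure). s i \<in> unit_cube"
    unfolding random_sites_eq by (intro AE_PiM_component prob_space_uniform_cube)
qed simp

text \<open>A measurable majorant is needed because the counting function itself is not known to be
  measurable, and the upper bounds for different \<open>L\<close> have to be added.\<close>
lemma light_sets_majorant:
  "\<exists>C\<ge>0. \<forall>n w L (dst :: real^'d \<Rightarrow> real^'d \<Rightarrow> real).
     cube_comparable dst \<and> L \<subseteq> {..<n} \<and> L \<noteq> {} \<and> (\<forall>i<n. 1 \<le> w i) \<longrightarrow>
     (\<exists>F \<in> borel_measurable (random_sites n).
        (AE s in random_sites n. of_nat (card (light_sets dst L m s w)) \<le> F s) \<and>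
        (\<integral>\<^sup>+ s. F s \<partial>random_sites n) \<le> ennreal (C * sum w L))"
proof -
  let ?d = "real CARD('d)"
  define g where "g = 1 / (4 * ?d) ^ CARD('d)"
  define K where "K = (8 * ?d) ^ CARD('d) * (12 ^ CARD('d)) ^ m * exp (real m + 1) * (1 + fact m / g ^ m)"
  have g0: "0 < g" by (simp add: g_def)
  have K0: "0 \<le> K" using g0 by (simp add: K_def)
  have d: "?d \<ge> 1" by (simp add: Suc_leI)
  show ?thesis
  proof (intro exI[of _ "2 * K"] conjI allI impI)
    show "0 \<le> 2 * K" using K0 by simp
    fix n :: nat and w :: "nat \<Rightarrow> real" and L :: "nat set" and dst :: "real^'d \<Rightarrow> real^'d \<Rightarrow> real"
    assume "cube_comparable dst \<and> L \<subseteq> {..<n} \<and> L \<noteq> {} \<and> (\<forall>i<n. 1 \<le> w i)"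
    hence dst: "cube_comparable dst" and L: "L \<subseteq> {..<n}" "L \<noteq> {}" and w: "\<And>i. i < n \<Longrightarrow> 1 \<le> w i" by auto
    have finL: "finite L" using L finite_subset by blast
    have wL: "1 \<le> w i" "1 \<le> omega TYPE('d) w i" if "i \<in> L" for i
    proof -
      show "1 \<le> w i" using that L w by auto
      thus "1 \<le> omega TYPE('d) w i" by (rule omega_ge_1)
    qed
    define S where "S = sum w L"
    have S1: "1 \<le> S"
    proof -
      obtain i where i: "i \<in> L" using L by blast
      have "0 \<le> w x" if "x \<in> L" for x using wL(1)[OF that] by simp
      hence "w i \<le> S" unfolding S_def using i finL by (intro member_le_sum) auto
      thus ?thesis using wL(1)[OF i] by simp
    qed
    \<comment> \<open>The starting scale solves \<open>S * R 0 ^ CARD('d) = 1\<close>: there the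
      expected number of sites of \<open>L\<close> reaching a given point is of constant
      order.\<close>
    define R where "R j = 2 ^ j * S powr (- 1 / ?d)" for j :: nat
    have R0: "0 < R j" for j using S1 by (simp add: R_def)
    have RSuc: "R (Suc j) = 2 * R j" for j by (simp add: R_def)
    have Rpow: "S * R j ^ CARD('d) = (2 ^ j) ^ CARD('d)" for j
    proof -
      have "(S powr (- 1 / ?d)) ^ CARD('d) = S powr (- 1 / ?d * ?d)"
        using S1 by (simp only: powr_powr[symmetric]) (simp add: powr_realpow)
      also have "\<dots> = 1 / S" using S1 by (simp add: powr_minus_divide)
      finally have "(S powr (- 1 / ?d)) ^ CARD('d) = 1 / S" .
      thus ?thesis using S1 by (simp add: R_def power_mult_distrib)
    qed
    have R00: "R 0 \<le> 1" using S1 powr_mono[of "-1/?d" 0 S] by (simp add: R_def)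
    define J where "J = {j. j = 0 \<or> (\<forall>i\<in>L. omega TYPE('d) w i * R j \<le> 2 * ?d)}"
    have RJ: "R j \<le> 2 * ?d" if "j \<in> J" for j
    proof (cases "j = 0")
      case True
      moreover have "1 \<le> 2 * ?d" using d by linarith
      ultimately show ?thesis using R00 by auto
    next
      case False
      obtain i where i: "i \<in> L" using L by blast
      have "R j \<le> omega TYPE('d) w i * R j" using wL(2)[OF i] R0[of j] by simp
      also have "\<dots> \<le> 2 * ?d" using False that i by (auto simp: J_def)
      finally show ?thesis .
    qed
    have unb: "\<exists>j. x \<le> R j" for x
    proof -
      obtain j :: nat where "x / R 0 < 2 ^ j" using real_arch_pow[of 2 "x / R 0"] by auto
      hence "x \<le> R j" using R0[of 0] by (simp add: R_def field_simps)
      thus ?thesis ..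
    qed
    have "finite J"
    proof -
      obtain j0 where j0: "2 * ?d + 1 \<le> R j0" using unb by blast
      have "j < j0" if "j \<in> J" for j
      proof (rule ccontr)
        assume "\<not> j < j0"
        hence "R j0 \<le> R j" using S1 by (simp add: R_def)
        thus False using RJ[OF that] j0 by simp
      qed
      thus ?thesis by (meson finite_nat_set_iff_bounded)
    qed
    have "\<forall>j\<in>J. \<exists>G :: (real^'d) set. finite G \<and> G \<subseteq> unit_cube \<and>
        real (card G) \<le> (8 * ?d / R j) ^ CARD('d) \<and>
        (\<forall>q\<in>unit_cube. \<exists>c\<in>G. \<forall>i. \<bar>q $ i - c $ i\<bar> \<le> R j / (4 * ?d))"
    proof
      fix j assume "j \<in> J"
      show "\<exists>G :: (real^'d) set. finite G \<and> G \<subseteq> unit_cube \<and>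
        real (card G) \<le> (8 * ?d / R j) ^ CARD('d) \<and>
        (\<forall>q\<in>unit_cube. \<exists>c\<in>G. \<forall>i. \<bar>q $ i - c $ i\<bar> \<le> R j / (4 * ?d))"
        by (rule unit_cube_grid[OF R0[of j] RJ[OF \<open>j \<in> J\<close>]]) blast
    qed
    from bchoice[OF this] obtain G :: "nat \<Rightarrow> (real^'d) set" where
      "\<forall>j\<in>J. finite (G j) \<and> G j \<subseteq> unit_cube \<and>
        real (card (G j)) \<le> (8 * ?d / R j) ^ CARD('d) \<and>
        (\<forall>q\<in>unit_cube. \<exists>c\<in>G j. \<forall>i. \<bar>q $ i - c $ i\<bar> \<le> R j / (4 * ?d))" ..
    hence G: "finite (G j)" "G j \<subseteq> unit_cube" "real (card (G j)) \<le> (8 * ?d / R j) ^ CARD('d)"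
        "\<And>q. q \<in> unit_cube \<Longrightarrow> \<exists>c\<in>G j. \<forall>i. \<bar>q $ i - c $ i\<bar> \<le> R j / (4 * ?d)" if "j \<in> J" for j
      using that by blast+
    let ?A = "{A. A \<subseteq> L \<and> card A = m}"
    have finA: "finite ?A" using finL by simp
    let ?E = "\<lambda>A j c. site_event n L w A c (R j) (j \<noteq> 0)"
    define F where "F s = (\<Sum>A\<in>?A. \<Sum>j\<in>J. \<Sum>c\<in>G j. indicator (?E A j c) s :: ennreal)" for s
    define P where "P A j = (\<Prod>i\<in>A. 12 ^ CARD('d) * (w i * R j ^ CARD('d))) *
      (if j \<noteq> 0 then \<Prod>i\<in>L-A. exp (- (w i * R j ^ CARD('d) / (4 * ?d) ^ CARD('d))) else 1)" for A j
    show "\<exists>F \<in> borel_measurable (random_sites n).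
        (AE s in random_sites n. of_nat (card (light_sets dst L m s w)) \<le> F s) \<and>
        (\<integral>\<^sup>+ s. F s \<partial>random_sites n) \<le> ennreal (2 * K * sum w L)"
    proof (intro bexI conjI)
      show "F \<in> borel_measurable (random_sites n)" unfolding F_def by measurable
      show "AE s in random_sites n. of_nat (card (light_sets dst L m s w)) \<le> F s"
        using AE_random_sites_unit_cube[of n] AE_space[of "random_sites n :: (nat \<Rightarrow> real^'d) measure"]
      proof eventually_elim
        case (elim s)
        have ext: "s \<in> extensional {..<n}"
          using elim(2) by (simp add: random_sites_eq space_PiM PiE_iff)
        \<comment> \<open>Each realised trace is caught by an event at some scale and grid point, so
          \<open>F\<close> counts it at least once.\<close>
        have cover: "\<exists>j\<in>J. \<exists>c\<in>G j. s \<in> ?E A j c" if A: "A \<in> light_sets dst L m s w" for A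
        proof -
          obtain q r where q: "q \<in> unit_cube" and r: "0 \<le> r"
            and inside: "\<And>i. i \<in> A \<Longrightarrow> dst (s i) q \<le> omega TYPE('d) w i * r"
            and outside: "\<And>i. i \<in> L - A \<Longrightarrow> omega TYPE('d) w i * r < dst (s i) q"
            and light: "\<And>i. i \<in> L \<Longrightarrow> omega TYPE('d) w i * r < ?d"
            using A unfolding light_sets_def by blast
          \<comment> \<open>For positive \<open>j\<close>, minimality gives
            \<open>R j < 2 * r\<close>, the lower bound on \<open>r\<close> that the flag
            demands.\<close>
          define j where "j = (LEAST j. r \<le> R j)"
          have rj: "r \<le> R j" unfolding j_def using unb by (rule LeastI_ex)
          have Rj: "R j \<le> 2 * r" if j0: "j \<noteq> 0"
          proof -
            obtain j' where j': "j = Suc j'" using not0_implies_Suc[OF j0] by blast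
            have "\<not> r \<le> R j'" by (rule not_less_Least) (simp add: j' flip: j_def)
            thus ?thesis using RSuc j' by simp
          qed
          have "j \<in> J"
          proof -
            have "omega TYPE('d) w i * R j \<le> 2 * ?d" if "j \<noteq> 0" "i \<in> L" for i
            proof -
              have "omega TYPE('d) w i * R j \<le> omega TYPE('d) w i * (2 * r)"
                using wL(2)[OF that(2)] Rj[OF that(1)] by (intro mult_left_mono) auto
              thus ?thesis using light[OF that(2)] by simp
            qed
            thus ?thesis by (auto simp: J_def)
          qed
          moreover obtain c where c: "c \<in> G j" "\<And>i. \<bar>q $ i - c $ i\<bar> \<le> R j / (4 * ?d)"
            using G(4)[OF \<open>j \<in> J\<close> q] by blast
          moreover have "s \<in> ?E A j c"
          proof (rule mem_site_eventI[OF dst L(1) _ w ext _ q R0 rj Rj inside outside c(2)])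
            show "A \<subseteq> L" using A by (simp add: light_sets_def)
            show "\<And>i. i < n \<Longrightarrow> s i \<in> unit_cube" using elim(1) by simp
          qed
          ultimately show ?thesis by blast
        qed
        have sub: "light_sets dst L m s w \<subseteq> ?A" by (auto simp: light_sets_def)
        have "(of_nat (card (light_sets dst L m s w)) :: ennreal)
            = (\<Sum>A\<in>light_sets dst L m s w. 1)" by simp
        also have "\<dots> \<le> (\<Sum>A\<in>light_sets dst L m s w. \<Sum>j\<in>J. \<Sum>c\<in>G j. indicator (?E A j c) s)"
        proof (rule sum_mono)
          fix A assume "A \<in> light_sets dst L m s w"
          then obtain j c where jc: "j \<in> J" "c \<in> G j" "s \<in> ?E A j c" using cover by blast
          have "(1 :: ennreal) = indicator (?E A j c) s" using jc by simp
          also have "\<dots> \<le> (\<Sum>c\<in>G j. indicator (?E A j c) s)"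
            using jc G(1) by (intro member_le_sum) auto
          also have "\<dots> \<le> (\<Sum>j\<in>J. \<Sum>c\<in>G j. indicator (?E A j c) s)"
            using jc \<open>finite J\<close> by (intro member_le_sum) auto
          finally show "1 \<le> (\<Sum>j\<in>J. \<Sum>c\<in>G j. indicator (?E A j c) s :: ennreal)" .
        qed
        also have "\<dots> \<le> F s" unfolding F_def by (rule sum_mono2[OF finA sub]) simp
        finally show ?case .
      qed
      have P0: "0 \<le> P A j" if "A \<subseteq> L" for A j
      proof -
        have "0 \<le> w i" if "i \<in> A" for i using wL(1)[of i] that \<open>A \<subseteq> L\<close> by auto
        thus ?thesis unfolding P_def using R0[of j] by (auto intro!: mult_nonneg_nonneg prod_nonneg)
      qed
      have "(\<integral>\<^sup>+ s. F s \<partial>random_sites n)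
          = (\<Sum>A\<in>?A. \<Sum>j\<in>J. \<Sum>c\<in>G j. emeasure (random_sites n) (?E A j c))"
        unfolding F_def by (simp add: nn_integral_sum)
      also have "\<dots> \<le> (\<Sum>A\<in>?A. \<Sum>j\<in>J. \<Sum>c\<in>G j. ennreal (P A j))"
      proof (intro sum_mono)
        fix A j c assume *: "A \<in> ?A" "j \<in> J" "c \<in> G j"
        show "emeasure (random_sites n) (?E A j c) \<le> ennreal (P A j)"
          unfolding P_def using * G(2) by (intro emeasure_site_event_le L R0 w) (auto simp: J_def)
      qed
      also have "\<dots> = ennreal (\<Sum>A\<in>?A. \<Sum>j\<in>J. \<Sum>c\<in>G j. P A j)"
        using P0 by (simp add: sum_nonneg del: sum_constant) (intro sum_ennreal sum_nonneg, auto)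
      \<comment> \<open>Grouping by scale lets the one-scale bound apply with
        \<open>y = (2 ^ j) ^ CARD('d)\<close>.\<close>
      also have "(\<Sum>A\<in>?A. \<Sum>j\<in>J. \<Sum>c\<in>G j. P A j) = (\<Sum>j\<in>J. \<Sum>A\<in>?A. \<Sum>c\<in>G j. P A j)"
        by (rule sum.swap)
      also have "\<dots> \<le> (\<Sum>j\<in>J. K * S * (1/2) ^ j)"
      proof (rule sum_mono)
        fix j assume j: "j \<in> J"
        have "(\<Sum>A\<in>?A. \<Sum>c\<in>G j. P A j) \<le> K * sum w L / (2 ^ j) ^ CARD('d)"
          unfolding K_def P_def
        proof (rule sum_scale_le[OF finL L(2) wL(1) R0 _ _ _ G(3)[OF j] g_def])
          show "(2 ^ j) ^ CARD('d) = sum w L * R j ^ CARD('d)" using Rpow by (simp add: S_def)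
        qed (use j in \<open>auto simp: J_def\<close>)
        \<comment> \<open>One factor \<open>2 ^ j\<close> already gives a geometric series of sum 2,
          the 2 in the constant \<open>2 * K\<close>.\<close>
        also have "\<dots> \<le> K * S / 2 ^ j"
        proof -
          have "(2 ^ j :: real) ^ 1 \<le> (2 ^ j) ^ CARD('d)"
            by (rule power_increasing) (auto simp: Suc_leI)
          thus ?thesis unfolding S_def using K0 S1 by (intro divide_left_mono) (auto simp: S_def)
        qed
        finally show "(\<Sum>A\<in>?A. \<Sum>c\<in>G j. P A j) \<le> K * S * (1/2) ^ j"
          by (simp add: power_one_over)
      qed
      also have "\<dots> = K * S * (\<Sum>j\<in>J. (1/2) ^ j)" by (simp add: sum_distrib_left)
      also have "\<dots> \<le> K * S * 2"
      proof (rule mult_left_mono)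
        have "(\<Sum>j\<in>J. (1/2::real) ^ j) \<le> (\<Sum>j. (1/2) ^ j)"
          using \<open>finite J\<close> by (intro sum_le_suminf summable_geometric) auto
        also have "\<dots> = 2" by (subst suminf_geometric) auto
        finally show "(\<Sum>j\<in>J. (1/2::real) ^ j) \<le> 2" .
      qed (use K0 S1 in auto)
      finally show "(\<integral>\<^sup>+ s. F s \<partial>random_sites n) \<le> ennreal (2 * K * sum w L)"
        by (simp add: S_def mult_ac ennreal_leI)
    qed
  qed
qed

section \<open>Splitting off the heavy sites\<close>

text \<open>The family depends on the weights alone and not on the random positions, so the sum over
  it can be taken outside the expectation.\<close>

definition heavy_sets :: "'d::finite itself \<Rightarrow> nat \<Rightarrow> nat \<Rightarrow> (nat \<Rightarrow> real) \<Rightarrow> nat set set" where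
  "heavy_sets (_::'d itself) n k w =
     {H. card H \<le> k \<and> (\<exists>r\<ge>0. H = {i. i < n \<and> real CARD('d) \<le> omega TYPE('d) w i * r})}"

lemma heavy_sets_subset: "H \<in> heavy_sets TYPE('d::finite) n k w \<Longrightarrow> H \<subseteq> {..<n}"
  by (auto simp: heavy_sets_def)

lemma finite_heavy_sets: "finite (heavy_sets TYPE('d::finite) n k w)"
  by (rule finite_subset[of _ "Pow {..<n}"]) (auto dest: heavy_sets_subset)

text \<open>The sets grow with \<open>r\<close> and hence form a chain, in which a member is
  determined by its size between 0 and \<open>k\<close>.\<close>

lemma card_heavy_sets_le: "card (heavy_sets TYPE('d::finite) n k w) \<le> k + 1"
proof -
  let ?H = "\<lambda>r. {i. i < n \<and> real CARD('d) \<le> omega TYPE('d) w i * r}"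
  have mono: "?H r \<subseteq> ?H r'" if "r \<le> r'" for r r'
  proof -
    have "omega TYPE('d) w i * r \<le> omega TYPE('d) w i * r'" for i
      using that by (intro mult_left_mono) (auto simp: omega_def)
    thus ?thesis using order_trans by blast
  qed
  have "inj_on card (heavy_sets TYPE('d) n k w)"
  proof (rule inj_onI)
    fix X Y assume *: "X \<in> heavy_sets TYPE('d) n k w" "Y \<in> heavy_sets TYPE('d) n k w" "card X = card Y"
    have fin: "finite X" "finite Y" using *(1,2)[THEN heavy_sets_subset] finite_subset by blast+
    obtain r r' where r: "X = ?H r" "Y = ?H r'" using * unfolding heavy_sets_def by blast
    have "X \<subseteq> Y \<or> Y \<subseteq> X" unfolding r using linear[of r r'] mono[of r r'] mono[of r' r] by argo
    thus "X = Y" using fin *(3) card_subset_eq[of Y X] card_subset_eq[of X Y] by auto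
  qed
  hence "card (heavy_sets TYPE('d) n k w) = card (card ` heavy_sets TYPE('d) n k w)"
    by (simp add: card_image)
  also have "\<dots> \<le> card {..k}" by (intro card_mono) (auto simp: heavy_sets_def)
  finally show ?thesis by simp
qed

text \<open>For a witness radius \<open>r\<close>, the heavy set \<open>H\<close> lies inside
  \<open>A\<close>, so \<open>A\<close> is recovered from \<open>H\<close> and its trace
  \<open>A - H\<close> on the other sites.\<close>

lemma num_regions_le_sum_light_sets:
  fixes s :: "nat \<Rightarrow> real^'d"
  assumes dst: "cube_comparable dst" and s: "\<And>i. i < n \<Longrightarrow> s i \<in> unit_cube"
    and w: "\<And>i. i < n \<Longrightarrow> 1 \<le> w i" and k: "k > 0"
  shows "num_regions dst n k s w \<le>
    (\<Sum>H\<in>heavy_sets TYPE('d) n k w. card (light_sets dst ({..<n} - H) (k - card H) s w))"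
proof -
  let ?HS = "heavy_sets TYPE('d) n k w" and ?LS = "\<lambda>H. light_sets dst ({..<n} - H) (k - card H) s w"
  have "{A. A \<subseteq> {..<n} \<and> card A = k \<and> voronoi_region dst n s w A \<noteq> {}}
      \<subseteq> (\<Union>H\<in>?HS. (\<lambda>A. A \<union> H) ` ?LS H)"
  proof
    fix A assume "A \<in> {A. A \<subseteq> {..<n} \<and> card A = k \<and> voronoi_region dst n s w A \<noteq> {}}"
    then obtain q r where A: "A \<subseteq> {..<n}" "card A = k" and q: "q \<in> unit_cube"
      and inside: "\<And>i. i \<in> A \<Longrightarrow> dst (s i) q \<le> omega TYPE('d) w i * r"
      and outside: "\<And>i. i \<in> {..<n} - A \<Longrightarrow> omega TYPE('d) w i * r < dst (s i) q"
      unfolding voronoi_region_def by blast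
    have finA: "finite A" using A finite_subset by blast
    \<comment> \<open>As \<open>k > 0\<close>, some site lies in \<open>A\<close>, and its
      nonnegative distance to \<open>q\<close> is at most a positive multiple of
      \<open>r\<close>.\<close>
    have r: "0 \<le> r"
    proof -
      obtain i where i: "i \<in> A" using A k by fastforce
      hence i': "i < n" using A by auto
      have "0 \<le> circ_dist (s i $ j) (q $ j)" for j
        using s[OF i'] q by (intro circ_dist_nonneg) (auto simp: unit_cube_def)
      also have "circ_dist (s i $ j) (q $ j) \<le> dst (s i) q" for j
        using dst s[OF i'] q by (auto simp: cube_comparable_def)
      also have "\<dots> \<le> omega TYPE('d) w i * r" by (rule inside[OF i])
      finally show ?thesis using omega_ge_1[where 'd='d, of w i] w[OF i'] by (auto simp: zero_le_mult_iff)
    qed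
    define H where "H = {i. i < n \<and> real CARD('d) \<le> omega TYPE('d) w i * r}"
    have "H \<subseteq> A"
    proof
      fix i assume i: "i \<in> H"
      hence i': "i < n" by (simp add: H_def)
      have "\<bar>s i $ j - q $ j\<bar> \<le> 1" for j
      proof -
        have "0 \<le> s i $ j" "s i $ j \<le> 1" "0 \<le> q $ j" "q $ j \<le> 1"
          using s[OF i'] q by (auto simp: unit_cube_def)
        thus ?thesis by linarith
      qed
      \<comment> \<open>The dimension bounds the diameter of the cube, so a heavy site cannot
        satisfy the strict inequality required outside \<open>A\<close>.\<close>
      hence "dst (s i) q \<le> real CARD('d) * 1"
        using dst s[OF i'] q unfolding cube_comparable_def by blast
      thus "i \<in> A" using i outside[of i] by (force simp: H_def)
    qed
    hence "card H \<le> k" using A finA card_mono by blast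
    hence "H \<in> ?HS" using r by (auto simp: heavy_sets_def H_def)
    moreover have "A - H \<in> ?LS H"
      unfolding light_sets_def
    proof (intro CollectI conjI bexI[of _ q] exI[of _ r])
      show "card (A - H) = k - card H" using A \<open>H \<subseteq> A\<close> finA by (simp add: card_Diff_subset finite_subset)
    qed (use A q r inside outside \<open>H \<subseteq> A\<close> in \<open>auto simp: H_def\<close>)
    moreover have "A = (A - H) \<union> H" using \<open>H \<subseteq> A\<close> by blast
    ultimately show "A \<in> (\<Union>H\<in>?HS. (\<lambda>A. A \<union> H) ` ?LS H)" by blast
  qed
  hence "num_regions dst n k s w \<le> card (\<Union>H\<in>?HS. (\<lambda>A. A \<union> H) ` ?LS H)"
    unfolding num_regions_def by (intro card_mono finite_UN_I finite_heavy_sets finite_imageI finite_light_sets) auto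
  also have "\<dots> \<le> (\<Sum>H\<in>?HS. card ((\<lambda>A. A \<union> H) ` ?LS H))" by (rule card_UN_le[OF finite_heavy_sets])
  also have "\<dots> \<le> (\<Sum>H\<in>?HS. card (?LS H))"
    by (intro sum_mono card_image_le finite_light_sets) auto
  finally show ?thesis .
qed

section \<open>The expectation bound for both distances\<close>

text \<open>The expected traces are summed over the at most \<open>k + 1\<close> heavy sets. The
  constant precedes \<open>dst\<close>, so one value serves the torus and the cube.\<close>

lemma expected_num_regions_le:
  "\<exists>C\<ge>0. \<forall>n w (dst :: real^'d \<Rightarrow> real^'d \<Rightarrow> real).
     cube_comparable dst \<and> n > 0 \<and> (\<forall>i<n. 1 \<le> w i) \<longrightarrow>
       (\<integral>\<^sup>+ s. ennreal (real (num_regions dst n k s w)) \<partial>random_sites n) \<le> ennreal (C * (\<Sum>i<n. w i))"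
proof -
  define P where "P m C \<longleftrightarrow> 0 \<le> C \<and> (\<forall>n w L (dst :: real^'d \<Rightarrow> real^'d \<Rightarrow> real).
     cube_comparable dst \<and> L \<subseteq> {..<n} \<and> L \<noteq> {} \<and> (\<forall>i<n. 1 \<le> w i) \<longrightarrow>
     (\<exists>F \<in> borel_measurable (random_sites n).
        (AE s in random_sites n. of_nat (card (light_sets dst L m s w)) \<le> F s) \<and>
        (\<integral>\<^sup>+ s. F s \<partial>random_sites n) \<le> ennreal (C * sum w L)))" for m C
  have "\<forall>m. \<exists>C. P m C" unfolding P_def using light_sets_majorant[where 'd='d] by blast
  then obtain c where "\<forall>m. P m (c m)" using choice[of P] by blast
  hence c: "0 \<le> c m" "cube_comparable dst \<Longrightarrow> L \<subseteq> {..<n} \<Longrightarrow> L \<noteq> {} \<Longrightarrow> \<forall>i<n. 1 \<le> w i \<Longrightarrow>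
     (\<exists>F \<in> borel_measurable (random_sites n).
        (AE s in random_sites n. of_nat (card (light_sets dst L m s w)) \<le> F s) \<and>
        (\<integral>\<^sup>+ s. F s \<partial>random_sites n) \<le> ennreal (c m * sum w L))"
    for m n w L and dst :: "real^'d \<Rightarrow> real^'d \<Rightarrow> real"
    unfolding P_def by blast+
  \<comment> \<open>Dominates the constants for all trace sizes \<open>k - card H\<close>; the added
    1 also covers the cases below in which the count is at most 1.\<close>
  define M where "M = 1 + (\<Sum>m\<le>k. c m)"
  have M: "1 \<le> M" "\<And>m. m \<le> k \<Longrightarrow> c m \<le> M"
  proof -
    show "1 \<le> M" unfolding M_def using c(1) by (simp add: sum_nonneg)
    fix m assume "m \<le> k"
    hence "c m \<le> (\<Sum>m\<le>k. c m)" using c(1) by (intro member_le_sum) auto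
    thus "c m \<le> M" by (simp add: M_def)
  qed
  show ?thesis
  proof (intro exI[of _ "(real k + 1) * M"] conjI allI impI)
    show "0 \<le> (real k + 1) * M" using M by simp
    fix n :: nat and w :: "nat \<Rightarrow> real" and dst :: "real^'d \<Rightarrow> real^'d \<Rightarrow> real"
    assume "cube_comparable dst \<and> n > 0 \<and> (\<forall>i<n. 1 \<le> w i)"
    hence dst: "cube_comparable dst" and n: "n > 0" and w: "\<And>i. i < n \<Longrightarrow> 1 \<le> w i" by auto
    let ?RS = "random_sites n :: (nat \<Rightarrow> real^'d) measure"
    interpret prob_space ?RS by (rule prob_space_random_sites)
    define W where "W = (\<Sum>i<n. w i)"
    have w0: "0 \<le> w i" if "i < n" for i using w[OF that] by simp
    have W1: "1 \<le> W"
    proof -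
      have "w 0 \<le> W" unfolding W_def using n w0 by (intro member_le_sum) auto
      thus ?thesis using w[OF n] by simp
    qed
    let ?HS = "heavy_sets TYPE('d) n k w" and ?LS = "\<lambda>H s. light_sets dst ({..<n} - H) (k - card H) s w"
    show "(\<integral>\<^sup>+ s. ennreal (real (num_regions dst n k s w)) \<partial>?RS) \<le> ennreal ((real k + 1) * M * (\<Sum>i<n. w i))"
    \<comment> \<open>For \<open>k = 0\<close> the witness radius may be negative, so the reduction
      to light traces does not apply; the empty set is the only candidate.\<close>
    proof (cases "k = 0")
      case True
      have "num_regions dst n k s w \<le> 1" for s
      proof -
        have "{A. A \<subseteq> {..<n} \<and> card A = k \<and> voronoi_region dst n s w A \<noteq> {}} \<subseteq> {{}}"
          using True by (auto dest: finite_subset)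
        from card_mono[OF _ this] show ?thesis by (simp add: num_regions_def)
      qed
      hence "(\<integral>\<^sup>+ s. ennreal (real (num_regions dst n k s w)) \<partial>?RS) \<le> (\<integral>\<^sup>+ s. 1 \<partial>?RS)"
        by (intro nn_integral_mono) (simp add: ennreal_le_1)
      also have "\<dots> = ennreal 1" by (simp add: emeasure_space_1)
      also have "\<dots> \<le> ennreal ((real k + 1) * M * W)"
        using M(1) W1 mult_mono[of 1 M 1 W] True by (intro ennreal_leI) auto
      finally show ?thesis by (simp add: W_def)
    next
      case False
      have "\<exists>F \<in> borel_measurable ?RS. (AE s in ?RS. of_nat (card (?LS H s)) \<le> F s) \<and>
          (\<integral>\<^sup>+ s. F s \<partial>?RS) \<le> ennreal (M * W)" if H: "H \<in> ?HS" for H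
      \<comment> \<open>If every site is heavy, the only possible trace is empty and the constant 1
        is a majorant.\<close>
      proof (cases "{..<n} - H = {}")
        case True
        have "card (?LS H s) \<le> 1" for s
        proof -
          have "?LS H s \<subseteq> {{}}" using True by (auto simp: light_sets_def)
          from card_mono[OF _ this] show ?thesis by simp
        qed
        hence "AE s in ?RS. (of_nat (card (?LS H s)) :: ennreal) \<le> 1"
          by (simp add: of_nat_le_1_iff)
        moreover have "(\<integral>\<^sup>+ s. 1 \<partial>?RS) \<le> ennreal (M * W)"
          using M(1) W1 mult_mono[of 1 M 1 W] by (simp add: emeasure_space_1 ennreal_ge_1)
        ultimately show ?thesis by (intro bexI[of _ "\<lambda>_. 1"]) auto
      next
        case False
        have "c (k - card H) * sum w ({..<n} - H) \<le> M * W"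
          unfolding W_def using M c(1) w0
          by (intro mult_mono sum_mono2 sum_nonneg) auto
        moreover obtain F where "F \<in> borel_measurable ?RS" "AE s in ?RS. of_nat (card (?LS H s)) \<le> F s"
          "(\<integral>\<^sup>+ s. F s \<partial>?RS) \<le> ennreal (c (k - card H) * sum w ({..<n} - H))"
          using c(2)[OF dst _ False, of n w "k - card H"] w by blast
        ultimately show ?thesis by (meson ennreal_leI order_trans)
      qed
      hence "\<forall>H\<in>?HS. \<exists>F. F \<in> borel_measurable ?RS \<and> (AE s in ?RS. of_nat (card (?LS H s)) \<le> F s) \<and>
          (\<integral>\<^sup>+ s. F s \<partial>?RS) \<le> ennreal (M * W)" by blast
      from bchoice[OF this] obtain F where
        "\<forall>H\<in>?HS. F H \<in> borel_measurable ?RS \<and> (AE s in ?RS. of_nat (card (?LS H s)) \<le> F H s) \<and>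
          (\<integral>\<^sup>+ s. F H s \<partial>?RS) \<le> ennreal (M * W)" ..
      hence F: "F H \<in> borel_measurable ?RS" "AE s in ?RS. of_nat (card (?LS H s)) \<le> F H s"
        "(\<integral>\<^sup>+ s. F H s \<partial>?RS) \<le> ennreal (M * W)" if "H \<in> ?HS" for H
        using that by blast+
      have "AE s in ?RS. \<forall>H\<in>?HS. of_nat (card (?LS H s)) \<le> F H s"
        by (intro AE_finite_allI finite_heavy_sets F)
      hence "AE s in ?RS. ennreal (real (num_regions dst n k s w)) \<le> (\<Sum>H\<in>?HS. F H s)"
        using AE_random_sites_unit_cube
      proof eventually_elim
        case (elim s)
        have "num_regions dst n k s w \<le> (\<Sum>H\<in>?HS. card (?LS H s))"
          using elim(2) False by (intro num_regions_le_sum_light_sets dst w) auto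
        hence "(of_nat (num_regions dst n k s w) :: ennreal) \<le> of_nat (\<Sum>H\<in>?HS. card (?LS H s))"
          by (rule of_nat_mono)
        also have "\<dots> \<le> (\<Sum>H\<in>?HS. F H s)" unfolding of_nat_sum using elim(1) by (intro sum_mono) auto
        finally show ?case by (simp add: ennreal_of_nat_eq_real_of_nat)
      qed
      hence "(\<integral>\<^sup>+ s. ennreal (real (num_regions dst n k s w)) \<partial>?RS) \<le> (\<integral>\<^sup>+ s. (\<Sum>H\<in>?HS. F H s) \<partial>?RS)"
        by (rule nn_integral_mono_AE)
      also have "\<dots> = (\<Sum>H\<in>?HS. \<integral>\<^sup>+ s. F H s \<partial>?RS)" using F(1) by (rule nn_integral_sum)
      also have "\<dots> \<le> (\<Sum>H\<in>?HS. ennreal (M * W))" by (intro sum_mono F)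
      also have "\<dots> = ennreal (real (card ?HS) * (M * W))"
        using M W1 by (simp add: ennreal_mult ennreal_of_nat_eq_real_of_nat)
      also have "\<dots> \<le> ennreal ((real k + 1) * (M * W))"
        using M W1 card_heavy_sets_le[where 'd='d, of n k w] by (intro ennreal_leI mult_right_mono) auto
      finally show ?thesis by (simp add: W_def mult_ac)
    qed
  qed
qed

theorem mainTheorem12:
  fixes p :: enat and k :: nat
  assumes "p \<ge> 1"
  shows "\<exists>C::real. \<forall>(n::nat) (w::nat \<Rightarrow> real).
           (\<forall>i<n. w i \<ge> 1) \<and> (\<exists>i<n. w i = 1) \<longrightarrow>
             (\<integral>\<^sup>+ s. ennreal (real (num_regions (torus_dist p :: real^'d \<Rightarrow> _) n k s w))
                 \<partial>(random_sites n :: (nat \<Rightarrow> real^'d) measure))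
               \<le> ennreal (C * (\<Sum>i<n. w i)) \<and>
             (\<integral>\<^sup>+ s. ennreal (real (num_regions (cube_dist p :: real^'d \<Rightarrow> _) n k s w))
                 \<partial>(random_sites n :: (nat \<Rightarrow> real^'d) measure))
               \<le> ennreal (C * (\<Sum>i<n. w i))"
proof -
  obtain C where C: "\<And>n w (dst :: real^'d \<Rightarrow> real^'d \<Rightarrow> real).
     cube_comparable dst \<and> n > 0 \<and> (\<forall>i<n. 1 \<le> w i) \<Longrightarrow>
       (\<integral>\<^sup>+ s. ennreal (real (num_regions dst n k s w)) \<partial>random_sites n) \<le> ennreal (C * (\<Sum>i<n. w i))"
    using expected_num_regions_le[where 'd='d, of k] by blast
  show ?thesis
    \<comment> \<open>The site of weight 1 supplies \<open>n > 0\<close>.\<close>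
    by (intro exI[of _ C] allI impI conjI C cube_comparable_torus_dist cube_comparable_cube_dist assms) auto
qed

end
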